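(* Let $\mathcal U(p,t)$ be a classical solution of the Hamilton–Jacobi equation on $\mathcal P(\mathcal X)$ $$\frac{\partial}{\partial t}\mathcal U(p,t)+\mathcal H(p,\nabla_p\mathcal U(p,t))=0,\quad t\le T,\qquad \mathcal U(p,T)=\mathcal G(p),$$ where $\mathcal H(p,\Phi)=\tfrac12\sum_{(i,j)\in E}H_{ij}\big((\overline\nabla_\omega\Phi)_{i,j}\big)\theta_{ij}(p)+\mathcal F(p)$. Then the vector function $u(p,t)=(u_i(p,t))_{i=1}^n$, $u_i(p,t)=\frac{\partial}{\partial p_i}\mathcal U(p,t)$, satisfies the master equation $$\frac{\partial}{\partial t}u_i(p,t)+D_{p_i}\mathcal H(p,u(p,t))=0,\quad t\le T,\qquad u(p,T)=\nabla_p\mathcal G(p),$$ where $D_{p_i}$ is the total derivative in $p_i$ of $p\mapsto\mathcal H(p,u(p,t))$; in detail, for $i=1,\dots,n$ and $t\le T$, $$\frac{\partial}{\partial t}u_i(p,t)+\sum_{j\in\mathcal N_i}H_{ij}\big((\overline\nabla_\omega u(p,t))_{i,j}\big)\frac{\partial}{\partial p_i}\theta_{ij}(p)+\frac{\partial}{\partial p_i}\mathcal F(p)+\frac12\sum_{(j,k)\in E}H'_{jk}\big((\overline\nabla_\omega u(p,t))_{j,k}\big)\,(\overline\nabla_\omega\nabla_pu_i(p,t))_{j,k}\,\theta_{jk}(p)=0,$$ with $u_i(p,T)=\frac{\partial}{\partial p_i}\mathcal G(p)$.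
   Context: $\mathcal X=\{1,\dots,n\}$ and $\mathcal P(\mathcal X)=\{p\in\mathbb R^n:\ p_i\ge0,\ \sum_ip_i=1\}$. $Q$ is the generator of a reversible continuous-time Markov chain on $\mathcal X$ ($Q_{ij}\ge0$ for $j\ne i$, zero row sums) with unique positive invariant measure $\pi$ satisfying $Q_{ij}\pi_i=Q_{ji}\pi_j$. Put $\omega_{ij}=Q_{ij}\pi_i$, $E=\{(i,j):i\ne j,\ \omega_{ij}>0\}$, $\mathcal N_i=\{j:(i,j)\in E\}$. Notation: $(\overline\nabla_\omega\Phi)_{i,j}=\sqrt{\omega_{ij}}(\Phi_j-\Phi_i)$, so $(\overline\nabla_\omega u(p,t))_{i,j}=\sqrt{\omega_{ij}}(u_j(p,t)-u_i(p,t))$ and $(\overline\nabla_\omega\nabla_pu_i(p,t))_{j,k}=\sqrt{\omega_{jk}}\big(\frac{\partial}{\partial p_k}u_i(p,t)-\frac{\partial}{\partial p_j}u_i(p,t)\big)$. The activation function $\theta:\mathbb R^+\times\mathbb R^+\to\mathbb R^+$ satisfies (i) $\theta(x,y)=\theta(y,x)$; (ii) $\theta(x,y)>0$ if $xy\ne0$; (iii) $\theta\in C^1$; (iv) $\theta(x,y)=0$ if $xy=0$; and $\theta_{ij}(p)=\theta(p_i/\pi_i,p_j/\pi_j)$. For $(i,j)\in E$, $L_{ij}:\mathbb R\to\mathbb R$ satisfies $L_{ij}=L_{ji}$, $L_{ij}(-a)=L_{ij}(a)$, $L_{ij}(0)=0$, and is strictly convex and coercive (superlinear); $H_{ij}(b)=\sup_{a\in\mathbb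 R}(ab-L_{ij}(a))$. $\mathcal F,\mathcal G\in C^1(\mathcal P(\mathcal X))$. Functions on $\mathcal P(\mathcal X)$ are treated as functions of the $n$ coordinates so that $\partial/\partial p_i$ and $\nabla_p$ make sense. Classical means that $\mathcal U$ has the continuous derivatives (including those of $u=\nabla_p\mathcal U$) appearing in the equations.
   Formalization: The Hamilton–Jacobi equation and terminal condition are assumed on a relatively open subset of the nonnegative orthant containing P(X), not only on P(X); otherwise adding (Σp_i−1)g(t) to U keeps them but breaks the master equation. *)

theory Defs
  imports "HOL-Analysis.Analysis"
begin

section \<open>The reversible Markov chain and its weighted graph\<close>

text \<open>The state space is the finite type \<open>'n\<close>. Row vectors act from the left, so invariance of
  \<open>\<mu>\<close> reads \<open>\<mu> v* Q = 0\<close>. Uniqueness is up to a positive factor; \<open>\<pi>\<close> need not be normalised to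
  total mass one (the normalised case is included).\<close>

definition reversible_generator :: "real^'n^'n \<Rightarrow> real^'n \<Rightarrow> bool" where
  "reversible_generator Q \<pi> \<longleftrightarrow>
     (\<forall>i j. i \<noteq> j \<longrightarrow> 0 \<le> Q$i$j) \<and>
     (\<forall>i. (\<Sum>j\<in>UNIV. Q$i$j) = 0) \<and>
     (\<forall>i. 0 < \<pi>$i) \<and>
     \<pi> v* Q = 0 \<and>
     (\<forall>\<mu>. (\<forall>i. 0 < \<mu>$i) \<and> \<mu> v* Q = 0 \<longrightarrow> (\<exists>c. \<mu> = c *\<^sub>R \<pi>)) \<and>
     (\<forall>i j. Q$i$j * \<pi>$i = Q$j$i * \<pi>$j)"

definition weight :: "real^'n^'n \<Rightarrow> real^'n \<Rightarrow> 'n \<Rightarrow> 'n \<Rightarrow> real" where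
  "weight Q \<pi> i j = Q$i$j * \<pi>$i"

definition edges :: "real^'n^'n \<Rightarrow> real^'n \<Rightarrow> ('n \<times> 'n) set" where
  "edges Q \<pi> = {(i, j). i \<noteq> j \<and> 0 < weight Q \<pi> i j}"

definition neighbours :: "real^'n^'n \<Rightarrow> real^'n \<Rightarrow> 'n \<Rightarrow> 'n set" where
  "neighbours Q \<pi> i = {j. (i, j) \<in> edges Q \<pi>}"

definition dgrad :: "real^'n^'n \<Rightarrow> real^'n \<Rightarrow> real^'n \<Rightarrow> 'n \<Rightarrow> 'n \<Rightarrow> real" where
  "dgrad Q \<pi> \<Phi> i j = sqrt (weight Q \<pi> i j) * (\<Phi>$j - \<Phi>$i)"


section \<open>Probability vectors and coordinate derivatives\<close>

definition prob_simplex :: "(real^'n) set" where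
  "prob_simplex = {p. (\<forall>i. 0 \<le> p$i) \<and> (\<Sum>i\<in>UNIV. p$i) = 1}"

text \<open>A partial derivative \<open>\<partial>/\<partial>p\<^sub>i\<close> leaves the simplex, so functions on the simplex are regarded as
  functions of the \<open>n\<close> nonnegative coordinates on a set \<open>D\<close> as below. Identities that are to be
  differentiated in \<open>p\<^sub>i\<close> have to be identities on such a \<open>D\<close>: a function agreeing with a given one only
  on the simplex can have different partial derivatives there.\<close>

definition coordinate_domain :: "(real^'n) set \<Rightarrow> bool" where
  "coordinate_domain D \<longleftrightarrow>
     prob_simplex \<subseteq> D \<and> openin (top_of_set {p. \<forall>i. 0 \<le> p$i}) D"

text \<open>Derivatives are taken within \<open>D\<close>, hence are one-sided where \<open>p\<^sub>i = 0\<close>; likewise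
  time derivatives are one-sided at the final time \<open>T\<close>.\<close>

definition coord_line :: "(real^'n) set \<Rightarrow> 'n \<Rightarrow> real^'n \<Rightarrow> real set" where
  "coord_line D i p = {s. p + s *\<^sub>R axis i 1 \<in> D}"

definition partial_p_exists :: "(real^'n) set \<Rightarrow> 'n \<Rightarrow> (real^'n \<Rightarrow> real) \<Rightarrow> real^'n \<Rightarrow> bool" where
  "partial_p_exists D i f p \<longleftrightarrow>
     (\<lambda>s. f (p + s *\<^sub>R axis i 1)) differentiable (at 0 within coord_line D i p)"

definition partial_p :: "(real^'n) set \<Rightarrow> 'n \<Rightarrow> (real^'n \<Rightarrow> real) \<Rightarrow> real^'n \<Rightarrow> real" where
  "partial_p D i f p =
     vector_derivative (\<lambda>s. f (p + s *\<^sub>R axis i 1)) (at 0 within coord_line D i p)"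

definition grad_p :: "(real^'n) set \<Rightarrow> (real^'n \<Rightarrow> real) \<Rightarrow> real^'n \<Rightarrow> real^'n" where
  "grad_p D f p = (\<chi> i. partial_p D i f p)"

definition partial_t :: "real \<Rightarrow> (real \<Rightarrow> real) \<Rightarrow> real \<Rightarrow> real" where
  "partial_t T g t = vector_derivative g (at t within {..T})"

definition C1_on :: "('a::real_normed_vector) set \<Rightarrow> ('a \<Rightarrow> real) \<Rightarrow> bool" where
  "C1_on S f \<longleftrightarrow> (\<exists>f' :: 'a \<Rightarrow> 'a \<Rightarrow>\<^sub>L real.
     (\<forall>x\<in>S. (f has_derivative blinfun_apply (f' x)) (at x within S)) \<and> continuous_on S f')"


section \<open>Activation function, Lagrangians and Hamiltonian\<close>

definition activation :: "(real \<Rightarrow> real \<Rightarrow> real) \<Rightarrow> bool" where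
  "activation \<theta> \<longleftrightarrow>
     (\<forall>x\<ge>0. \<forall>y\<ge>0. 0 \<le> \<theta> x y \<and> \<theta> x y = \<theta> y x \<and>
        (x * y \<noteq> 0 \<longrightarrow> 0 < \<theta> x y) \<and> (x * y = 0 \<longrightarrow> \<theta> x y = 0)) \<and>
     C1_on ({0..} \<times> {0..}) (\<lambda>(x, y). \<theta> x y)"

definition edge_activation ::
    "(real \<Rightarrow> real \<Rightarrow> real) \<Rightarrow> real^'n \<Rightarrow> 'n \<Rightarrow> 'n \<Rightarrow> real^'n \<Rightarrow> real" where
  "edge_activation \<theta> \<pi> i j p = \<theta> (p$i / \<pi>$i) (p$j / \<pi>$j)"

definition strictly_convex :: "(real \<Rightarrow> real) \<Rightarrow> bool" where
  "strictly_convex f \<longleftrightarrow> (\<forall>x y s. x \<noteq> y \<and> 0 < s \<and> s < 1 \<longrightarrow>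
     f ((1 - s) * x + s * y) < (1 - s) * f x + s * f y)"

definition edge_lagrangians :: "('n \<times> 'n) set \<Rightarrow> ('n \<Rightarrow> 'n \<Rightarrow> real \<Rightarrow> real) \<Rightarrow> bool" where
  "edge_lagrangians E L \<longleftrightarrow> (\<forall>(i, j)\<in>E.
     L i j = L j i \<and> (\<forall>a. L i j (- a) = L i j a) \<and> L i j 0 = 0 \<and> strictly_convex (L i j) \<and>
     filterlim (\<lambda>a. L i j a / \<bar>a\<bar>) at_top at_infinity)"

text \<open>For superlinear \<open>L\<close> bounded below on bounded sets the supremum is over a set bounded above,
  so the conditionally complete supremum on the reals is the actual one.\<close>

definition legendre :: "(real \<Rightarrow> real) \<Rightarrow> real \<Rightarrow> real" where
  "legendre L b = (SUP a. a * b - L a)"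

definition hamiltonian ::
    "real^'n^'n \<Rightarrow> real^'n \<Rightarrow> (real \<Rightarrow> real \<Rightarrow> real) \<Rightarrow> ('n \<Rightarrow> 'n \<Rightarrow> real \<Rightarrow> real) \<Rightarrow>
     (real^'n \<Rightarrow> real) \<Rightarrow> real^'n \<Rightarrow> real^'n \<Rightarrow> real" where
  "hamiltonian Q \<pi> \<theta> L F p \<Phi> =
     1/2 * (\<Sum>(i, j)\<in>edges Q \<pi>. legendre (L i j) (dgrad Q \<pi> \<Phi> i j) * edge_activation \<theta> \<pi> i j p)
     + F p"


section \<open>Classical solutions of the Hamilton--Jacobi equation\<close>

definition cont_partial_t :: "(real^'n) set \<Rightarrow> real \<Rightarrow> (real^'n \<Rightarrow> real \<Rightarrow> real) \<Rightarrow> bool" where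
  "cont_partial_t D T V \<longleftrightarrow>
     (\<forall>p\<in>D. \<forall>t\<le>T. V p differentiable (at t within {..T})) \<and>
     continuous_on (D \<times> {..T}) (\<lambda>(p, t). partial_t T (V p) t)"

definition cont_partial_p :: "(real^'n) set \<Rightarrow> real \<Rightarrow> 'n \<Rightarrow> (real^'n \<Rightarrow> real \<Rightarrow> real) \<Rightarrow> bool" where
  "cont_partial_p D T i V \<longleftrightarrow>
     (\<forall>p\<in>D. \<forall>t\<le>T. partial_p_exists D i (\<lambda>q. V q t) p) \<and>
     continuous_on (D \<times> {..T}) (\<lambda>(p, t). partial_p D i (\<lambda>q. V q t) p)"

text \<open>Regularity: the derivatives of \<open>U\<close> and of \<open>u = \<nabla>\<^sub>p U\<close> occurring in the Hamilton--Jacobi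
  and the master equation are required to exist and to be jointly continuous.\<close>

definition classical_regularity :: "(real^'n) set \<Rightarrow> real \<Rightarrow> (real^'n \<Rightarrow> real \<Rightarrow> real) \<Rightarrow> bool" where
  "classical_regularity D T U \<longleftrightarrow>
     cont_partial_t D T U \<and>
     (\<forall>i. cont_partial_p D T i U \<and>
          cont_partial_t D T (\<lambda>p t. partial_p D i (\<lambda>q. U q t) p) \<and>
          (\<forall>k. cont_partial_p D T k (\<lambda>p t. partial_p D i (\<lambda>q. U q t) p)))"

definition classical_HJ_solution ::
    "(real^'n) set \<Rightarrow> real \<Rightarrow> (real^'n \<Rightarrow> real^'n \<Rightarrow> real) \<Rightarrow> (real^'n \<Rightarrow> real) \<Rightarrow>
     (real^'n \<Rightarrow> real \<Rightarrow> real) \<Rightarrow> bool" where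
  "classical_HJ_solution D T Ham G U \<longleftrightarrow>
     classical_regularity D T U \<and>
     (\<forall>p\<in>D. \<forall>t\<le>T. partial_t T (U p) t + Ham p (grad_p D (\<lambda>q. U q t) p) = 0) \<and>
     (\<forall>p\<in>D. U p T = G p)"

end

theory Submission
  imports Defs
begin

text \<open>The master equation is the Hamilton--Jacobi equation differentiated in \<open>p\<^sub>i\<close>. Write
  \<open>\<H>\<close> for the Hamiltonian and \<open>u\<^sub>i = \<partial>U/\<partial>p\<^sub>i\<close>. Formally,
  \<open>\<partial>\<^sub>t u\<^sub>i = \<partial>\<^sub>i \<partial>\<^sub>t U = - \<partial>\<^sub>i [\<H>(p, u(p, t))]\<close>, and the chain rule expands the right-hand side.
  Three points need an argument.

  First, \<open>\<partial>\<^sub>t\<close> and \<open>\<partial>\<^sub>i\<close> have to be interchanged although only \<open>\<partial>\<^sub>t \<partial>\<^sub>i U\<close> is known to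
  exist, not \<open>\<partial>\<^sub>i \<partial>\<^sub>t U\<close>. Peano's form of Schwarz's theorem, \<open>mixed_partial_derivatives\<close>, fits
  this: given the first derivatives, continuity of one mixed derivative yields existence of the
  other and their equality.
  As the equation says that \<open>\<partial>\<^sub>t U\<close> is \<open>- \<H>(p, u(p, t))\<close>, the total derivative of
  \<open>\<H>(p, u(p, t))\<close> exists and equals \<open>- \<partial>\<^sub>t u\<^sub>i\<close>, before any chain rule is applied. The lemma is
  stated on products of arbitrary intervals, so that the faces of the orthant and the final time,
  where derivatives are one-sided, need no separate treatment.

  Second, the chain rule needs \<open>H\<^sub>j\<^sub>k\<close> to be differentiable. The Legendre transform of a strictly
  convex superlinear \<open>L\<close> has as derivative at \<open>b\<close> the unique maximizer of \<open>a b - L(a)\<close>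
  (\<open>has_real_derivative_legendre\<close>), by an elementary stability estimate for that maximizer.

  Third, the chain rule produces the differences of \<open>\<partial>\<^sub>i u\<^sub>k\<close> over edges, whereas the master equation
  contains those of \<open>\<partial>\<^sub>k u\<^sub>i\<close>. These agree by Schwarz's theorem again (\<open>partial_p_symmetric\<close>). In
  \<open>\<Sum> H\<^sub>j\<^sub>k \<partial>\<^sub>i\<theta>\<^sub>j\<^sub>k\<close> only the edges at \<open>i\<close> contribute, and each is counted in both
  orientations with equal contributions, which cancels the factor \<open>1/2\<close>
  (\<open>edge_sum_only_incident\<close>).\<close>

section \<open>The Legendre transform of a strictly convex superlinear function\<close>

lemma convex_on_strictly_convex:
  assumes "strictly_convex f" shows "convex_on UNIV f"
proof (rule convex_onI)
  fix t x y :: real assume t: "0 < t" "t < 1"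
  show "f ((1 - t) *\<^sub>R x + t *\<^sub>R y) \<le> (1 - t) * f x + t * f y"
  proof (cases "x = y")
    case True then show ?thesis by (simp add: algebra_simps)
  next
    case False
    then show ?thesis using assms t unfolding strictly_convex_def by (auto intro: less_imp_le)
  qed
qed simp

lemma strictly_convex_minus_linear:
  assumes "strictly_convex f" shows "strictly_convex (\<lambda>a. f a - a * b)"
  unfolding strictly_convex_def
proof (intro allI impI)
  fix x y s :: real assume "x \<noteq> y \<and> 0 < s \<and> s < 1"
  with assms have "f ((1 - s) * x + s * y) < (1 - s) * f x + s * f y"
    unfolding strictly_convex_def by blast
  then show "f ((1 - s) * x + s * y) - ((1 - s) * x + s * y) * b
      < (1 - s) * (f x - x * b) + s * (f y - y * b)"
    by (simp add: algebra_simps)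
qed

text \<open>Superlinearity confines the competition to a compact interval, on which the convex, hence
  continuous, function \<open>L\<close> allows a maximum.\<close>

lemma legendre_maximizer_exists:
  assumes "strictly_convex L" and sup: "filterlim (\<lambda>a. L a / \<bar>a\<bar>) at_top at_infinity"
  obtains a0 where "\<And>a. a * b - L a \<le> a0 * b - L a0"
proof -
  \<comment> \<open>Slope \<open>\<bar>b\<bar> + 1\<close> beats the linear term; the surplus \<open>\<bar>L 0\<bar>\<close> makes every far point lose against
    \<open>a = 0\<close>.\<close>
  let ?M = "\<bar>b\<bar> + 1 + \<bar>L 0\<bar>"
  have "\<forall>\<^sub>F a in at_infinity. ?M \<le> L a / \<bar>a\<bar>"
    using sup by (simp add: filterlim_at_top)
  then obtain R where R: "\<And>a. norm a \<ge> R \<Longrightarrow> ?M \<le> L a / \<bar>a\<bar>"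
    unfolding eventually_at_infinity by blast
  define r where "r = max R 1"
  have out: "a * b - L a \<le> - L 0" if "r \<le> \<bar>a\<bar>" for a
  proof -
    have a: "\<bar>a\<bar> \<ge> 1" and "?M \<le> L a / \<bar>a\<bar>"
      using that R[of a] by (auto simp: r_def)
    then have "?M * \<bar>a\<bar> \<le> L a" by (simp add: pos_le_divide_eq)
    moreover have "a * b \<le> \<bar>b\<bar> * \<bar>a\<bar>" by (metis abs_ge_self abs_mult mult.commute)
    moreover have "\<bar>L 0\<bar> * 1 \<le> \<bar>L 0\<bar> * \<bar>a\<bar>" using a by (intro mult_left_mono) auto
    ultimately show ?thesis using a abs_ge_self[of "L 0"] by (simp add: algebra_simps)
  qed
  have "continuous_on UNIV L"
    by (rule convex_on_continuous[OF open_UNIV convex_on_strictly_convex[OF assms(1)]])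
  then have "continuous_on (cball 0 r) (\<lambda>a. a * b - L a)"
    by (intro continuous_intros) (auto intro: continuous_on_subset)
  moreover have "cball (0::real) r \<noteq> {}" by (auto simp: r_def)
  ultimately obtain a0 where a0: "\<And>a. a \<in> cball 0 r \<Longrightarrow> a * b - L a \<le> a0 * b - L a0"
    using continuous_attains_sup[OF compact_cball] by blast
  have "a * b - L a \<le> a0 * b - L a0" for a
  proof (cases "\<bar>a\<bar> \<le> r")
    case True then show ?thesis using a0[of a] by simp
  next
    case False
    then have "a * b - L a \<le> - L 0" using out by simp
    also have "\<dots> \<le> a0 * b - L a0" using a0[of 0] by (simp add: r_def)
    finally show ?thesis .
  qed
  then show thesis using that by blast
qed

lemma legendre_eq_maximum:
  assumes "\<And>a. a * b - L a \<le> a0 * b - L a0"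
  shows "legendre L b = a0 * b - L a0"
  unfolding legendre_def by (rule cSup_eq_maximum) (use assms in auto)

text \<open>Quantitative uniqueness of the minimizer: outside an \<open>\<epsilon>\<close>-neighbourhood convexity propagates the
  positive gap at the two points \<open>a0 \<plusminus> \<epsilon>\<close> linearly to infinity. A linear lower bound is what is
  needed to absorb a linear perturbation of \<open>f\<close>.\<close>

lemma strictly_convex_linear_growth:
  assumes f: "strictly_convex f" and min: "\<And>a. f a0 \<le> f a" and "0 < \<epsilon>"
  obtains \<gamma> where "0 < \<gamma>" "\<And>a. \<epsilon> \<le> \<bar>a - a0\<bar> \<Longrightarrow> f a0 + \<gamma> * \<bar>a - a0\<bar> \<le> f a"
proof -
  have strict: "f a0 < f a" if "a \<noteq> a0" for a
  proof -
    have "f ((1 - 1/2) * a0 + 1/2 * a) < (1 - 1/2) * f a0 + 1/2 * f a"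
      using f[unfolded strictly_convex_def, rule_format, of a0 a "1/2"] that by auto
    then show ?thesis using min[of "(1 - 1/2) * a0 + 1/2 * a"] by simp
  qed
  define g where "g = min (f (a0 + \<epsilon>)) (f (a0 - \<epsilon>)) - f a0"
  have g: "0 < g" using strict[of "a0 + \<epsilon>"] strict[of "a0 - \<epsilon>"] \<open>0 < \<epsilon>\<close> by (simp add: g_def)
  show thesis
  proof
    show "0 < g / \<epsilon>" using g \<open>0 < \<epsilon>\<close> by simp
    fix a assume a: "\<epsilon> \<le> \<bar>a - a0\<bar>"
    \<comment> \<open>The point at distance \<open>\<epsilon>\<close> from \<open>a0\<close> on the segment from \<open>a0\<close> to \<open>a\<close>.\<close>
    define s where "s = \<epsilon> / \<bar>a - a0\<bar>"
    have s: "0 < s" "s \<le> 1" "s * \<bar>a - a0\<bar> = \<epsilon>" using a \<open>0 < \<epsilon>\<close> by (auto simp: s_def)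
    have "g + f a0 \<le> f ((1 - s) *\<^sub>R a0 + s *\<^sub>R a)"
    proof (cases "a0 \<le> a")
      case True
      then have "(1 - s) *\<^sub>R a0 + s *\<^sub>R a = a0 + \<epsilon>" using s(3) by (simp add: algebra_simps)
      then show ?thesis by (simp add: g_def)
    next
      case False
      then have "(1 - s) *\<^sub>R a0 + s *\<^sub>R a = a0 - \<epsilon>" using s(3) by (simp add: algebra_simps)
      then show ?thesis by (simp add: g_def)
    qed
    also have "\<dots> \<le> (1 - s) * f a0 + s * f a"
      using convex_onD[OF convex_on_strictly_convex[OF f], of s a0 a] s by simp
    finally have "g \<le> s * (f a - f a0)" by (simp add: algebra_simps)
    then have "g / s \<le> f a - f a0" using s by (simp add: field_simps)
    moreover have "g / s = g / \<epsilon> * \<bar>a - a0\<bar>" using s a \<open>0 < \<epsilon>\<close> by (auto simp: s_def)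
    ultimately show "f a0 + g / \<epsilon> * \<bar>a - a0\<bar> \<le> f a" by simp
  qed
qed

text \<open>If \<open>a0\<close> and \<open>a1\<close> maximize at \<open>b\<close> and \<open>b'\<close>, comparing each with the other's problem gives
  \<open>a0 (b' - b) \<le> H(b') - H(b) \<le> a1 (b' - b)\<close> for the Legendre transform \<open>H\<close> of \<open>L\<close>. So it suffices
  that \<open>a1\<close> is close to \<open>a0\<close> when \<open>b'\<close> is close to \<open>b\<close>: the problem at \<open>b'\<close> is a linear perturbation
  with slope \<open>b' - b\<close> of the one at \<open>b\<close>, and cannot move the maximizer out of an
  \<open>e\<close>-neighbourhood once that slope is below the growth rate \<open>\<gamma>\<close>.\<close>

lemma has_real_derivative_legendre:
  assumes L: "strictly_convex L" "filterlim (\<lambda>a. L a / \<bar>a\<bar>) at_top at_infinity"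
    and a0: "\<And>a. a * b - L a \<le> a0 * b - L a0"
  shows "(legendre L has_real_derivative a0) (at b)"
  unfolding has_field_derivative_def has_derivative_within_alt
proof (intro conjI allI impI)
  show "bounded_linear ((*) a0)" by (rule bounded_linear_mult_right)
  fix e :: real assume "0 < e"
  have min: "L a0 - a0 * b \<le> L a - a * b" for a using a0[of a] by simp
  obtain \<gamma> where \<gamma>: "0 < \<gamma>"
    and growth: "\<And>a. e \<le> \<bar>a - a0\<bar> \<Longrightarrow> L a0 - a0 * b + \<gamma> * \<bar>a - a0\<bar> \<le> L a - a * b"
    using strictly_convex_linear_growth[OF strictly_convex_minus_linear[OF L(1), of b] min \<open>0 < e\<close>]
    by blast
  have "norm (legendre L b' - legendre L b - a0 * (b' - b)) \<le> e * norm (b' - b)"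
    if b': "norm (b' - b) < \<gamma>" for b'
  proof -
    obtain a1 where a1: "\<And>a. a * b' - L a \<le> a1 * b' - L a1"
      using legendre_maximizer_exists[OF L] by blast
    have near: "\<bar>a1 - a0\<bar> \<le> e"
    proof (rule ccontr)
      assume far: "\<not> \<bar>a1 - a0\<bar> \<le> e"
      have "\<gamma> * \<bar>a1 - a0\<bar> \<le> (a1 - a0) * (b' - b)"
        using growth[of a1] a1[of a0] far by (simp add: algebra_simps)
      also have "\<dots> \<le> \<bar>a1 - a0\<bar> * \<bar>b' - b\<bar>" by (metis abs_ge_self abs_mult)
      also have "\<dots> < \<bar>a1 - a0\<bar> * \<gamma>" using b' far \<open>0 < e\<close> by (intro mult_strict_left_mono) auto
      finally show False by (simp add: mult.commute)
    qed
    have eq: "legendre L b' = a1 * b' - L a1" "legendre L b = a0 * b - L a0"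
      using legendre_eq_maximum[of b' L a1] legendre_eq_maximum[of b L a0] a1 a0 by blast+
    have "0 \<le> legendre L b' - legendre L b - a0 * (b' - b)"
      using a1[of a0] by (simp add: eq algebra_simps)
    moreover have "legendre L b' - legendre L b - a0 * (b' - b) \<le> (a1 - a0) * (b' - b)"
      using a0[of a1] by (simp add: eq algebra_simps)
    moreover have "(a1 - a0) * (b' - b) \<le> \<bar>a1 - a0\<bar> * \<bar>b' - b\<bar>" by (metis abs_ge_self abs_mult)
    moreover have "\<bar>a1 - a0\<bar> * \<bar>b' - b\<bar> \<le> e * \<bar>b' - b\<bar>" using near by (rule mult_right_mono) simp
    ultimately show ?thesis by simp
  qed
  with \<gamma> show "\<exists>d>0. \<forall>y\<in>UNIV. norm (y - b) < d \<longrightarrow>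
      norm (legendre L y - legendre L b - a0 * (y - b)) \<le> e * norm (y - b)"
    by blast
qed

lemma legendre_differentiable:
  assumes "strictly_convex L" "filterlim (\<lambda>a. L a / \<bar>a\<bar>) at_top at_infinity"
  shows "legendre L differentiable (at b)"
  using legendre_maximizer_exists[OF assms, of b] has_real_derivative_legendre[OF assms]
    real_differentiable_def by metis

lemma legendre_even:
  assumes "\<And>a. L (- a) = L a"
  shows "legendre L (- b) = legendre L b"
proof -
  have "range (\<lambda>a. a * - b - L a) = (\<lambda>a. a * b - L a) ` range uminus"
    unfolding image_image using assms by simp
  then show ?thesis by (simp add: legendre_def)
qed

section \<open>Interchanging partial derivatives on a product of intervals\<close>

text \<open>Peano's version of Schwarz's theorem. With \<open>c\<close> the mixed derivative at \<open>(a, b)\<close>, the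
  function \<open>W x y - c x y\<close> has a mixed derivative of absolute value at most \<open>e\<close> near \<open>(a, b)\<close>. Two
  applications of the mean value inequality bound its second difference over the rectangle with
  corners \<open>(a, b)\<close> and \<open>(x, y)\<close> by \<open>e \<bar>x - a\<bar> \<bar>y - b\<bar>\<close>. Dividing by \<open>y - b\<close> and letting \<open>y\<close> tend to
  \<open>b\<close> leaves the first-order estimate that defines the derivative of \<open>Wy\<close> at \<open>a\<close>. Convexity of \<open>A\<close>
  and \<open>B\<close> serves the mean value inequality, and endpoints are allowed for \<open>a\<close> and \<open>b\<close>.\<close>

lemma mixed_partial_derivatives:
  fixes W Wx Wxy :: "real \<Rightarrow> real \<Rightarrow> real" and Wy :: "real \<Rightarrow> real"
  assumes AB: "convex A" "convex B" "a \<in> A" "b \<in> B" and nontriv: "at b within B \<noteq> bot"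
    and Wx: "\<And>x y. \<lbrakk>x \<in> A; y \<in> B\<rbrakk> \<Longrightarrow> ((\<lambda>x. W x y) has_real_derivative Wx x y) (at x within A)"
    and Wxy: "\<And>x y. \<lbrakk>x \<in> A; y \<in> B\<rbrakk> \<Longrightarrow> (Wx x has_real_derivative Wxy x y) (at y within B)"
    and Wy: "\<And>x. x \<in> A \<Longrightarrow> (W x has_real_derivative Wy x) (at b within B)"
    and cont: "continuous_on (A \<times> B) (\<lambda>(x, y). Wxy x y)"
  shows "(Wy has_real_derivative Wxy a b) (at a within A)"
  unfolding has_field_derivative_def has_derivative_within_alt
proof (intro conjI allI impI)
  let ?c = "Wxy a b"
  show "bounded_linear ((*) ?c)" by (rule bounded_linear_mult_right)
  fix e :: real assume "0 < e"
  then obtain d where d: "0 < d"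
    and close: "\<And>x y. \<lbrakk>x \<in> A; y \<in> B; dist (x, y) (a, b) < d\<rbrakk> \<Longrightarrow> \<bar>Wxy x y - ?c\<bar> < e"
    using cont[unfolded continuous_on_iff, rule_format, of "(a, b)" e] AB
    by (auto simp: dist_real_def)
  have close': "\<bar>Wxy x y - ?c\<bar> \<le> e"
    if "x \<in> A \<inter> ball a (d/2)" "y \<in> B \<inter> ball b (d/2)" for x y
  proof -
    have "dist (x, y) (a, b) \<le> dist x a + dist y b"
      unfolding dist_prod_def by (simp add: sqrt_sum_squares_le_sum)
    also have "\<dots> < d" using that by (simp add: dist_commute)
    finally show ?thesis using close[of x y] that by simp
  qed
  have mixed: "\<bar>W x y - W x b - (W a y - W a b) - (x - a) * ((y - b) * ?c)\<bar>
      \<le> e * \<bar>y - b\<bar> * \<bar>x - a\<bar>"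
    if x: "x \<in> A \<inter> ball a (d/2)" and y: "y \<in> B \<inter> ball b (d/2)" for x y
  proof -
    have inner: "\<bar>Wx x' y - Wx x' b - (y - b) * ?c\<bar> \<le> e * \<bar>y - b\<bar>"
      if x': "x' \<in> A \<inter> ball a (d/2)" for x'
    proof -
      have "norm ((Wx x' y - y * ?c) - (Wx x' b - b * ?c)) \<le> e * norm (y - b)"
      proof (rule field_differentiable_bound[where f' = "\<lambda>y. Wxy x' y - ?c"])
        show "convex (B \<inter> ball b (d/2))" using AB by (simp add: convex_Int)
        fix z assume z: "z \<in> B \<inter> ball b (d/2)"
        then have "(Wx x' has_real_derivative Wxy x' z) (at z within B \<inter> ball b (d/2))"
          using Wxy[of x' z] x' by (auto intro: DERIV_subset)
        then show "((\<lambda>y. Wx x' y - y * ?c) has_real_derivative Wxy x' z - ?c)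
            (at z within B \<inter> ball b (d/2))"
          by (auto intro!: derivative_eq_intros)
        show "norm (Wxy x' z - ?c) \<le> e" using close' x' z by simp
      qed (use y AB d in auto)
      then show ?thesis by (simp add: algebra_simps)
    qed
    have "norm ((W x y - W x b - x * ((y - b) * ?c)) - (W a y - W a b - a * ((y - b) * ?c)))
        \<le> e * \<bar>y - b\<bar> * norm (x - a)"
    proof (rule field_differentiable_bound
        [where f' = "\<lambda>x. Wx x y - Wx x b - (y - b) * ?c"])
      show "convex (A \<inter> ball a (d/2))" using AB by (simp add: convex_Int)
      fix z assume z: "z \<in> A \<inter> ball a (d/2)"
      then have "((\<lambda>x. W x y) has_real_derivative Wx z y) (at z within A \<inter> ball a (d/2))"
        "((\<lambda>x. W x b) has_real_derivative Wx z b) (at z within A \<inter> ball a (d/2))"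
        using Wx[of z y] Wx[of z b] y AB by (auto intro: DERIV_subset)
      then show "((\<lambda>x. W x y - W x b - x * ((y - b) * ?c)) has_real_derivative
          Wx z y - Wx z b - (y - b) * ?c) (at z within A \<inter> ball a (d/2))"
        by (auto intro!: derivative_eq_intros)
      show "norm (Wx z y - Wx z b - (y - b) * ?c) \<le> e * \<bar>y - b\<bar>" using inner[OF z] by simp
    qed (use x AB d in auto)
    then show ?thesis by (simp add: algebra_simps)
  qed
  have "norm (Wy x - Wy a - ?c * (x - a)) \<le> e * norm (x - a)"
    if x: "x \<in> A" "norm (x - a) < d/2" for x
  proof -
    have quot: "((\<lambda>y. (W x y - W x b) / (y - b) - (W a y - W a b) / (y - b) - (x - a) * ?c)
        \<longlongrightarrow> Wy x - Wy a - (x - a) * ?c) (at b within B)"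
      using Wy[OF \<open>x \<in> A\<close>] Wy[OF \<open>a \<in> A\<close>] unfolding has_field_derivative_iff
      by (intro tendsto_intros)
    have "\<forall>\<^sub>F y in at b within B. y \<in> B \<inter> ball b (d/2) \<and> y \<noteq> b"
      unfolding eventually_at using d by (intro exI[of _ "d/2"]) (auto simp: dist_commute)
    then have "\<forall>\<^sub>F y in at b within B.
        norm ((W x y - W x b) / (y - b) - (W a y - W a b) / (y - b) - (x - a) * ?c) \<le> e * \<bar>x - a\<bar>"
    proof eventually_elim
      case (elim y)
      have "(W x y - W x b) / (y - b) - (W a y - W a b) / (y - b) - (x - a) * ?c
          = (W x y - W x b - (W a y - W a b) - (x - a) * ((y - b) * ?c)) / (y - b)"
        using elim by (simp add: diff_divide_distrib)
      then show ?case
        using mixed[of x y] x elim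
        by (simp add: dist_real_def abs_minus_commute pos_divide_le_eq mult_ac)
    qed
    then have "norm (Wy x - Wy a - (x - a) * ?c) \<le> e * \<bar>x - a\<bar>"
      by (rule Lim_norm_ubound[OF nontriv quot])
    then show ?thesis by (simp add: mult.commute)
  qed
  then show "\<exists>d>0. \<forall>y\<in>A. norm (y - a) < d \<longrightarrow>
      norm (Wy y - Wy a - ?c * (y - a)) \<le> e * norm (y - a)"
    using d by (intro exI[of _ "d/2"]) auto
qed

section \<open>Coordinate derivatives on a coordinate domain\<close>

lemma coordinate_domain_nonneg:
  assumes "coordinate_domain D" "p \<in> D" shows "0 \<le> p $ i"
  using assms openin_imp_subset unfolding coordinate_domain_def by fastforce

lemma coordinate_domain_ball:
  fixes D :: "(real^'n) set"
  assumes "coordinate_domain D" "p \<in> D"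
  obtains \<delta> where "0 < \<delta>" "\<And>q. \<lbrakk>\<And>j. 0 \<le> q $ j; dist q p < \<delta>\<rbrakk> \<Longrightarrow> q \<in> D"
  using assms unfolding coordinate_domain_def openin_euclidean_subtopology_iff by blast

text \<open>A coordinate line through \<open>D\<close> can be disconnected, but near \<open>p\<close> it is an interval, which is what
  the mean value inequality needs.\<close>

lemma coord_line_locally_interval:
  fixes D :: "(real^'n) set"
  assumes "coordinate_domain D" "p \<in> D"
  obtains \<delta> where "0 < \<delta>"
    "coord_line D i p \<inter> ball 0 \<delta> = {s. \<bar>s\<bar> < \<delta> \<and> 0 \<le> p $ i + s}"
proof -
  obtain \<delta> where \<delta>: "0 < \<delta>" "\<And>q. \<lbrakk>\<And>j. 0 \<le> q $ j; dist q p < \<delta>\<rbrakk> \<Longrightarrow> q \<in> D"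
    using coordinate_domain_ball[OF assms] by blast
  have "coord_line D i p \<inter> ball 0 \<delta> = {s. \<bar>s\<bar> < \<delta> \<and> 0 \<le> p $ i + s}"
  proof (intro equalityI subsetI)
    fix s assume "s \<in> coord_line D i p \<inter> ball 0 \<delta>"
    then show "s \<in> {s. \<bar>s\<bar> < \<delta> \<and> 0 \<le> p $ i + s}"
      using coordinate_domain_nonneg[OF assms(1), of "p + s *\<^sub>R axis i 1" i]
      by (auto simp: coord_line_def axis_def)
  next
    fix s assume s: "s \<in> {s. \<bar>s\<bar> < \<delta> \<and> 0 \<le> p $ i + s}"
    have "p + s *\<^sub>R axis i 1 \<in> D"
      by (rule \<delta>(2)) (use s coordinate_domain_nonneg[OF assms] in
          \<open>auto simp: axis_def dist_norm norm_axis_1[unfolded axis_def]\<close>)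
    then show "s \<in> coord_line D i p \<inter> ball 0 \<delta>" using s by (simp add: coord_line_def)
  qed
  with \<delta>(1) show thesis using that by blast
qed

lemma at_zero_within_coord_line_nontrivial:
  fixes D :: "(real^'n) set"
  assumes "coordinate_domain D" "p \<in> D"
  shows "at 0 within coord_line D i p \<noteq> bot"
proof -
  obtain \<delta> where \<delta>: "0 < \<delta>"
    "coord_line D i p \<inter> ball 0 \<delta> = {s. \<bar>s\<bar> < \<delta> \<and> 0 \<le> p $ i + s}"
    using coord_line_locally_interval[OF assms] by blast
  have "{0<..<\<delta>} \<subseteq> coord_line D i p \<inter> ball 0 \<delta>"
    unfolding \<delta>(2) using coordinate_domain_nonneg[OF assms, of i] by auto
  moreover have "0 islimpt {0<..<\<delta>}" using \<delta>(1) by (rule islimpt_greaterThanLessThan1)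
  ultimately show ?thesis
    by (metis inf.boundedE islimpt_subset trivial_limit_within)
qed

lemma has_derivative_coord_lineD:
  fixes D :: "(real^'n) set"
  assumes "coordinate_domain D" "p \<in> D"
    and "((\<lambda>s. f (p + s *\<^sub>R axis i 1)) has_real_derivative d) (at 0 within coord_line D i p)"
  shows "partial_p_exists D i f p" "partial_p D i f p = d"
proof -
  have v: "((\<lambda>s. f (p + s *\<^sub>R axis i 1)) has_vector_derivative d) (at 0 within coord_line D i p)"
    using assms(3) by (simp add: has_real_derivative_iff_has_vector_derivative)
  then show "partial_p_exists D i f p"
    unfolding partial_p_exists_def by (rule differentiableI_vector)
  show "partial_p D i f p = d"
    unfolding partial_p_def
    by (rule vector_derivative_within[OF at_zero_within_coord_line_nontrivial[OF assms(1,2)] v])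
qed

lemma has_derivative_partial_p:
  assumes "partial_p_exists D i f p"
  shows "((\<lambda>s. f (p + s *\<^sub>R axis i 1)) has_real_derivative partial_p D i f p)
    (at 0 within coord_line D i p)"
  using assms unfolding partial_p_exists_def partial_p_def
    has_real_derivative_iff_has_vector_derivative vector_derivative_works .

text \<open>\<open>partial_p\<close> is a derivative at parameter \<open>0\<close> of the line based at the point in question; here the
  same number is the derivative at parameter \<open>s\<close> of the line based at \<open>p\<close>.\<close>

lemma has_derivative_partial_p_shift:
  assumes "partial_p_exists D i f (p + s *\<^sub>R axis i 1)"
    and A: "\<And>x. x \<in> A \<Longrightarrow> p + x *\<^sub>R axis i 1 \<in> D"
  shows "((\<lambda>x. f (p + x *\<^sub>R axis i 1)) has_real_derivative partial_p D i f (p + s *\<^sub>R axis i 1))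
    (at s within A)"
proof -
  let ?q = "p + s *\<^sub>R axis i 1"
  have eq: "?q + (x - s) *\<^sub>R axis i 1 = p + x *\<^sub>R axis i 1" for x by (simp add: algebra_simps)
  have sub: "(\<lambda>x. x - s) ` A \<subseteq> coord_line D i ?q"
    using A by (auto simp: coord_line_def eq)
  have "((\<lambda>h. f (?q + h *\<^sub>R axis i 1)) has_real_derivative partial_p D i f ?q)
      (at (s - s) within (\<lambda>x. x - s) ` A)"
    using has_field_derivative_subset[OF has_derivative_partial_p[OF assms(1)] sub] by simp
  moreover have "((\<lambda>x. x - s) has_real_derivative 1) (at s within A)"
    by (auto intro!: derivative_eq_intros)
  ultimately have "((\<lambda>h. f (?q + h *\<^sub>R axis i 1)) \<circ> (\<lambda>x. x - s) has_real_derivative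
      partial_p D i f ?q * 1) (at s within A)"
    by (rule DERIV_image_chain)
  then show ?thesis by (simp add: o_def eq del: add_diff_cancel)
qed

lemma partial_p_exists_if_has_derivative:
  fixes D :: "(real^'n) set"
  assumes "(f has_derivative f') (at p within D)"
  shows "partial_p_exists D i f p"
proof -
  have g: "((\<lambda>s. p + s *\<^sub>R axis i 1) has_derivative (\<lambda>s. s *\<^sub>R axis i 1))
      (at 0 within coord_line D i p)"
    by (auto intro!: derivative_eq_intros)
  have "(f has_derivative f') (at (p + 0 *\<^sub>R axis i 1) within (\<lambda>s. p + s *\<^sub>R axis i 1) ` coord_line D i p)"
    using assms by (auto simp: coord_line_def intro: has_derivative_subset)
  from diff_chain_within[OF g this] show ?thesis
    unfolding partial_p_exists_def differentiable_def o_def by blast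
qed

text \<open>The equality holds whether or not the derivatives exist: on the coordinate line both functions
  have the same derivative candidates, so the choice operator behind \<open>partial_p\<close> selects the same
  one.\<close>

lemma partial_p_cong:
  assumes "p \<in> D" "\<And>q. q \<in> D \<Longrightarrow> f q = g q"
  shows "partial_p D i f p = partial_p D i g p"
proof -
  have *: "\<And>s. s \<in> coord_line D i p \<Longrightarrow> f (p + s *\<^sub>R axis i 1) = g (p + s *\<^sub>R axis i 1)"
    using assms(2) by (simp add: coord_line_def)
  have z: "0 \<in> coord_line D i p" using assms(1) by (simp add: coord_line_def)
  have "((\<lambda>s. f (p + s *\<^sub>R axis i 1)) has_vector_derivative d) (at 0 within coord_line D i p) \<longleftrightarrow>
      ((\<lambda>s. g (p + s *\<^sub>R axis i 1)) has_vector_derivative d) (at 0 within coord_line D i p)" for d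
    using has_vector_derivative_transform[OF z, of "\<lambda>s. f (p + s *\<^sub>R axis i 1)" "\<lambda>s. g (p + s *\<^sub>R axis i 1)" d]
      has_vector_derivative_transform[OF z, of "\<lambda>s. g (p + s *\<^sub>R axis i 1)" "\<lambda>s. f (p + s *\<^sub>R axis i 1)" d] *
    by metis
  then show ?thesis unfolding partial_p_def vector_derivative_def by presburger
qed

text \<open>For \<open>i \<noteq> k\<close>, near \<open>p\<close> the plane through \<open>p\<close> in the directions \<open>i\<close> and \<open>k\<close> meets \<open>D\<close> in a
  product of two intervals, possibly with \<open>p\<close> at its corner, so \<open>mixed_partial_derivatives\<close> applies.\<close>

lemma partial_p_symmetric:
  fixes D :: "(real^'n) set" and f :: "real^'n \<Rightarrow> real"
  assumes D: "coordinate_domain D" "p \<in> D"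
    and f: "\<And>i q. q \<in> D \<Longrightarrow> partial_p_exists D i f q"
    and ff: "\<And>q. q \<in> D \<Longrightarrow> partial_p_exists D k (partial_p D i f) q"
    and cont: "continuous_on D (partial_p D k (partial_p D i f))"
  shows "partial_p D i (partial_p D k f) p = partial_p D k (partial_p D i f) p"
proof (cases "i = k")
  case False
  let ?e = "\<lambda>i. axis i (1::real) :: real^'n"
  obtain \<delta> where \<delta>: "0 < \<delta>" "\<And>q. \<lbrakk>\<And>j. 0 \<le> q $ j; dist q p < \<delta>\<rbrakk> \<Longrightarrow> q \<in> D"
    using coordinate_domain_ball[OF D] by blast
  \<comment> \<open>Half the radius, so that simultaneous displacements in both directions stay in the ball.\<close>
  define I where "I j = {s. \<bar>s\<bar> < \<delta>/2 \<and> 0 \<le> p $ j + s}" for j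
  have box: "p + s *\<^sub>R ?e i + r *\<^sub>R ?e k \<in> D" if "s \<in> I i" "r \<in> I k" for s r
  proof (rule \<delta>(2))
    show "0 \<le> (p + s *\<^sub>R ?e i + r *\<^sub>R ?e k) $ j" for j
      using that False coordinate_domain_nonneg[OF D, of j] by (auto simp: I_def axis_def)
    have "dist (p + s *\<^sub>R ?e i + r *\<^sub>R ?e k) p = norm (s *\<^sub>R ?e i + r *\<^sub>R ?e k)"
      by (simp add: dist_norm add.assoc)
    also have "\<dots> \<le> \<bar>s\<bar> + \<bar>r\<bar>" using norm_triangle_ineq[of "s *\<^sub>R ?e i" "r *\<^sub>R ?e k"]
      by (simp add: norm_axis_1)
    also have "\<dots> < \<delta>" using that by (auto simp: I_def)
    finally show "dist (p + s *\<^sub>R ?e i + r *\<^sub>R ?e k) p < \<delta>" .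
  qed
  have I: "convex (I j)" "0 \<in> I j" for j
  proof -
    have "I j = {-(\<delta>/2)<..<\<delta>/2} \<inter> {- p $ j..}" by (auto simp: I_def)
    then show "convex (I j)" by (simp add: convex_Int)
    show "0 \<in> I j" using \<delta>(1) coordinate_domain_nonneg[OF D] by (simp add: I_def)
  qed
  have at: "at 0 within I j = at 0 within coord_line D j p" if "j = i \<or> j = k" for j
  proof (rule at_within_nhd[of _ "{-(\<delta>/2)<..<\<delta>/2}"])
    have "s \<in> coord_line D j p" if "s \<in> I j" for s
      using box[of s 0] box[of 0 s] \<open>j = i \<or> j = k\<close> that I(2) by (auto simp: coord_line_def)
    moreover have "s \<in> I j" if "s \<in> coord_line D j p" "\<bar>s\<bar> < \<delta>/2" for s
      using that coordinate_domain_nonneg[OF D(1), of "p + s *\<^sub>R ?e j" j]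
      by (auto simp: I_def coord_line_def axis_def)
    ultimately show "I j \<inter> {-(\<delta>/2)<..<\<delta>/2} - {0} = coord_line D j p \<inter> {-(\<delta>/2)<..<\<delta>/2} - {0}"
      by (auto simp: abs_less_iff)
  qed (use \<delta> in auto)
  have "((\<lambda>s. partial_p D k f (p + s *\<^sub>R ?e i)) has_real_derivative
      partial_p D k (partial_p D i f) (p + 0 *\<^sub>R ?e i + 0 *\<^sub>R ?e k)) (at 0 within I i)"
  proof (rule mixed_partial_derivatives[where B = "I k" and b = 0
        and W = "\<lambda>s r. f (p + s *\<^sub>R ?e i + r *\<^sub>R ?e k)"
        and Wx = "\<lambda>s r. partial_p D i f (p + s *\<^sub>R ?e i + r *\<^sub>R ?e k)"
        and Wxy = "\<lambda>s r. partial_p D k (partial_p D i f) (p + s *\<^sub>R ?e i + r *\<^sub>R ?e k)"])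
    show "at 0 within I k \<noteq> bot"
      using at_zero_within_coord_line_nontrivial[OF D] by (simp add: at)
    fix s r assume s: "s \<in> I i" and r: "r \<in> I k"
    have eq: "p + x *\<^sub>R ?e i + r *\<^sub>R ?e k = (p + r *\<^sub>R ?e k) + x *\<^sub>R ?e i" for x
      by (simp add: algebra_simps)
    show "((\<lambda>s. f (p + s *\<^sub>R ?e i + r *\<^sub>R ?e k)) has_real_derivative
        partial_p D i f (p + s *\<^sub>R ?e i + r *\<^sub>R ?e k)) (at s within I i)"
      unfolding eq
      by (rule has_derivative_partial_p_shift) (use f box s r in \<open>auto simp flip: eq\<close>)
    show "((\<lambda>r. partial_p D i f (p + s *\<^sub>R ?e i + r *\<^sub>R ?e k)) has_real_derivative
        partial_p D k (partial_p D i f) (p + s *\<^sub>R ?e i + r *\<^sub>R ?e k)) (at r within I k)"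
      by (rule has_derivative_partial_p_shift) (use ff box s r in auto)
  next
    fix s assume s: "s \<in> I i"
    have "partial_p_exists D k f (p + s *\<^sub>R ?e i + 0 *\<^sub>R ?e k)"
      using f box[OF s I(2)] by blast
    from has_derivative_partial_p_shift[OF this, of "I k"] box[OF s]
    show "((\<lambda>r. f (p + s *\<^sub>R ?e i + r *\<^sub>R ?e k)) has_real_derivative
        partial_p D k f (p + s *\<^sub>R ?e i)) (at 0 within I k)"
      by auto
  next
    show "continuous_on (I i \<times> I k)
        (\<lambda>(s, r). partial_p D k (partial_p D i f) (p + s *\<^sub>R ?e i + r *\<^sub>R ?e k))"
      unfolding case_prod_unfold
      by (rule continuous_on_compose2[OF cont]) (use box in \<open>auto intro!: continuous_intros\<close>)
  qed (use I in auto)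
  then have "((\<lambda>s. partial_p D k f (p + s *\<^sub>R ?e i)) has_real_derivative
      partial_p D k (partial_p D i f) p) (at 0 within coord_line D i p)"
    by (simp add: at)
  then show ?thesis using has_derivative_coord_lineD(2)[OF D] by blast
qed simp

text \<open>The conclusion includes that \<open>\<partial>\<^sub>t U\<close> is differentiable in \<open>p\<^sub>i\<close>, which is not among the hypotheses.
  This is where the total derivative of the Hamiltonian comes from.\<close>

lemma partial_t_partial_p_commute:
  fixes D :: "(real^'n) set" and U :: "real^'n \<Rightarrow> real \<Rightarrow> real"
  assumes D: "coordinate_domain D" "p \<in> D" and t: "t \<le> T"
    and Ut: "cont_partial_t D T U" and Ui: "cont_partial_p D T i U"
    and Uit: "cont_partial_t D T (\<lambda>p t. partial_p D i (\<lambda>q. U q t) p)"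
  shows "((\<lambda>s. partial_t T (U (p + s *\<^sub>R axis i 1)) t) has_real_derivative
      partial_t T (\<lambda>t. partial_p D i (\<lambda>q. U q t) p) t) (at 0 within coord_line D i p)"
proof -
  let ?e = "axis i (1::real) :: real^'n"
  let ?u = "\<lambda>p t. partial_p D i (\<lambda>q. U q t) p"
  obtain \<delta> where \<delta>: "0 < \<delta>"
    "coord_line D i p \<inter> ball 0 \<delta> = {s. \<bar>s\<bar> < \<delta> \<and> 0 \<le> p $ i + s}"
    using coord_line_locally_interval[OF D] by blast
  let ?I = "coord_line D i p \<inter> ball 0 \<delta>"
  have "?I = {-\<delta><..<\<delta>} \<inter> {- p $ i..}" unfolding \<delta>(2) by auto
  then have convex: "convex ?I" by (simp add: convex_Int)
  have line: "p + s *\<^sub>R ?e \<in> D" if "s \<in> ?I" for s using that by (simp add: coord_line_def)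
  have time: "(V q has_real_derivative partial_t T (V q) s) (at s within {..T})"
    if "cont_partial_t D T V" "q \<in> D" "s \<le> T" for V :: "real^'n \<Rightarrow> real \<Rightarrow> real" and q s
    using that unfolding cont_partial_t_def partial_t_def
    by (simp add: has_real_derivative_iff_has_vector_derivative vector_derivative_works)
  have "((\<lambda>s. partial_t T (U (p + s *\<^sub>R ?e)) t) has_real_derivative
      partial_t T (?u (p + 0 *\<^sub>R ?e)) t) (at 0 within ?I)"
  proof (rule mixed_partial_derivatives[where B = "{..T}" and b = t
        and W = "\<lambda>s. U (p + s *\<^sub>R ?e)"
        and Wx = "\<lambda>s. ?u (p + s *\<^sub>R ?e)"
        and Wxy = "\<lambda>s t. partial_t T (?u (p + s *\<^sub>R ?e)) t"])
    have "at t within {..<t} \<le> at t within {..T}" using t by (intro at_le) auto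
    then show "at t within {..T} \<noteq> bot"
      using trivial_limit_at_left_real[of t] by (metis bot_unique)
    fix s y assume s: "s \<in> ?I" and y: "y \<in> {..T}"
    show "((\<lambda>s. U (p + s *\<^sub>R ?e) y) has_real_derivative ?u (p + s *\<^sub>R ?e) y) (at s within ?I)"
      by (rule has_derivative_partial_p_shift)
        (use Ui s y line in \<open>auto simp: cont_partial_p_def\<close>)
    show "(?u (p + s *\<^sub>R ?e) has_real_derivative partial_t T (?u (p + s *\<^sub>R ?e)) y)
        (at y within {..T})"
      using time[OF Uit line[OF s]] y by simp
  next
    fix s assume s: "s \<in> ?I"
    show "(U (p + s *\<^sub>R ?e) has_real_derivative partial_t T (U (p + s *\<^sub>R ?e)) t) (at t within {..T})"
      using time[OF Ut line[OF s] t] .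
  next
    have "continuous_on (D \<times> {..T}) (\<lambda>(p, t). partial_t T (?u p) t)"
      using Uit by (simp add: cont_partial_t_def)
    then have "continuous_on (?I \<times> {..T})
        (\<lambda>x. (\<lambda>(p, t). partial_t T (?u p) t) (p + fst x *\<^sub>R ?e, snd x))"
      by (rule continuous_on_compose2) (use line in \<open>auto intro!: continuous_intros\<close>)
    then show "continuous_on (?I \<times> {..T}) (\<lambda>(s, t). partial_t T (?u (p + s *\<^sub>R ?e)) t)"
      by (simp add: case_prod_unfold)
  qed (use convex t \<delta>(1) D in \<open>auto simp: coord_line_def\<close>)
  moreover have "at 0 within ?I = at 0 within coord_line D i p"
    by (rule at_within_nhd[of _ "ball 0 \<delta>"]) (use \<delta>(1) in auto)
  ultimately show ?thesis by simp
qed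

section \<open>The reversible weights and the total derivative of the Hamiltonian\<close>

lemma weight_symmetric:
  assumes "reversible_generator Q \<pi>" shows "weight Q \<pi> i j = weight Q \<pi> j i"
  using assms by (simp add: reversible_generator_def weight_def)

text \<open>Since \<open>D\<close> lies in the nonnegative orthant, the rescaled coordinates stay in the closed quadrant on
  which \<open>\<theta>\<close> is differentiable, and the chain rule within sets applies up to the boundary.\<close>

lemma edge_activation_has_derivative:
  fixes \<pi> :: "real^'n" and D :: "(real^'n) set"
  assumes \<theta>: "activation \<theta>" and \<pi>: "\<And>i. 0 < \<pi> $ i" and D: "coordinate_domain D" "p \<in> D"
  shows "\<exists>f'. (edge_activation \<theta> \<pi> j k has_derivative f') (at p within D)"
proof -
  let ?g = "\<lambda>q::real^'n. (q $ j / \<pi> $ j, q $ k / \<pi> $ k)"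
  have nn: "?g q \<in> {0..} \<times> {0..}" if "q \<in> D" for q
    using coordinate_domain_nonneg[OF D(1) that] \<pi> by (auto intro!: divide_nonneg_pos)
  obtain \<theta>' where "((\<lambda>(x, y). \<theta> x y) has_derivative \<theta>') (at (?g p) within {0..} \<times> {0..})"
    using \<theta> nn[OF D(2)] unfolding activation_def C1_on_def by blast
  then have h: "((\<lambda>(x, y). \<theta> x y) has_derivative \<theta>') (at (?g p) within ?g ` D)"
    by (rule has_derivative_subset) (use nn in auto)
  have "bounded_linear ?g"
    by (auto intro!: bounded_linear_Pair bounded_linear_divide bounded_linear_vec_nth
        bounded_linear_compose[OF bounded_linear_divide bounded_linear_vec_nth])
  then have "(?g has_derivative ?g) (at p within D)"
    by (rule bounded_linear_imp_has_derivative)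
  from diff_chain_within[OF this h] show ?thesis
    unfolding o_def edge_activation_def case_prod_unfold fst_conv snd_conv by blast
qed

text \<open>The surviving edges are \<open>(i, j)\<close> and \<open>(j, i)\<close> for the neighbours \<open>j\<close> of \<open>i\<close>; the two families
  are disjoint and contribute equally.\<close>

lemma edge_sum_only_incident:
  fixes g :: "'n::finite \<Rightarrow> 'n \<Rightarrow> real"
  assumes E: "\<And>j k. (j, k) \<in> E \<Longrightarrow> j \<noteq> k \<and> (k, j) \<in> E"
    and g: "\<And>j k. (j, k) \<in> E \<Longrightarrow> g j k = g k j"
    and zero: "\<And>j k. (j, k) \<in> E \<Longrightarrow> j \<noteq> i \<Longrightarrow> k \<noteq> i \<Longrightarrow> g j k = 0"
  shows "(\<Sum>(j, k)\<in>E. g j k) = 2 * (\<Sum>j\<in>{j. (i, j) \<in> E}. g i j)"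
proof -
  let ?N = "{j. (i, j) \<in> E}"
  have "(\<Sum>(j, k)\<in>E. g j k) = (\<Sum>(j, k)\<in>Pair i ` ?N \<union> (\<lambda>j. (j, i)) ` ?N. g j k)"
  proof (rule sum.mono_neutral_right)
    show "\<forall>x\<in>E - (Pair i ` ?N \<union> (\<lambda>j. (j, i)) ` ?N). (case x of (j, k) \<Rightarrow> g j k) = 0"
    proof
      fix x assume x: "x \<in> E - (Pair i ` ?N \<union> (\<lambda>j. (j, i)) ` ?N)"
      obtain j k where jk: "x = (j, k)" by fastforce
      then have "j \<noteq> i" "k \<noteq> i" using x E by blast+
      then show "(case x of (j, k) \<Rightarrow> g j k) = 0" using zero x jk by auto
    qed
  qed (use E in auto)
  also have "\<dots> = (\<Sum>(j, k)\<in>Pair i ` ?N. g j k) + (\<Sum>(j, k)\<in>(\<lambda>j. (j, i)) ` ?N. g j k)"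
    by (rule sum.union_disjoint) (use E in auto)
  also have "\<dots> = (\<Sum>j\<in>?N. g i j) + (\<Sum>j\<in>?N. g j i)"
    by (subst (1 2) sum.reindex) (auto simp: inj_on_def)
  also have "(\<Sum>j\<in>?N. g j i) = (\<Sum>j\<in>?N. g i j)"
    by (rule sum.cong) (use g in auto)
  finally show ?thesis by simp
qed

text \<open>The chain rule along a coordinate line, for an arbitrary vector field \<open>v\<close> in place of \<open>\<nabla>\<^sub>p U\<close>:
  here the differences are still those of the \<open>\<partial>\<^sub>i v\<^sub>k\<close>, since exchanging the indices requires \<open>v\<close> to
  be a gradient. Reversibility, evenness of the Lagrangians and symmetry of \<open>\<theta>\<close> make the two
  orientations of an edge contribute equally to the derivative of the activation.\<close>

lemma hamiltonian_total_derivative: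
  fixes Q :: "real^'n^'n" and v :: "real^'n \<Rightarrow> real^'n"
  assumes Q: "reversible_generator Q \<pi>" and \<theta>: "activation \<theta>"
    and L: "edge_lagrangians (edges Q \<pi>) L"
    and D: "coordinate_domain D" "p \<in> D" and F: "partial_p_exists D i F p"
    and v: "\<And>k. partial_p_exists D i (\<lambda>q. v q $ k) p"
  shows "partial_p D i (\<lambda>q. hamiltonian Q \<pi> \<theta> L F q (v q)) p =
      (\<Sum>j\<in>neighbours Q \<pi> i.
         legendre (L i j) (dgrad Q \<pi> (v p) i j) * partial_p D i (edge_activation \<theta> \<pi> i j) p)
      + partial_p D i F p
      + 1/2 * (\<Sum>(j, k)\<in>edges Q \<pi>.
         deriv (legendre (L j k)) (dgrad Q \<pi> (v p) j k)
         * dgrad Q \<pi> (\<chi> k. partial_p D i (\<lambda>q. v q $ k) p) j k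
         * edge_activation \<theta> \<pi> j k p)"
proof -
  let ?E = "edges Q \<pi>" and ?e = "axis i (1::real) :: real^'n"
  let ?w = "\<chi> k. partial_p D i (\<lambda>q. v q $ k) p"
  let ?at = "at 0 within coord_line D i p"
  let ?A = "\<lambda>j k. legendre (L j k) (dgrad Q \<pi> (v p) j k) * partial_p D i (edge_activation \<theta> \<pi> j k) p"
  let ?B = "\<lambda>j k. deriv (legendre (L j k)) (dgrad Q \<pi> (v p) j k) * dgrad Q \<pi> ?w j k
      * edge_activation \<theta> \<pi> j k p"
  have \<pi>: "\<And>i. 0 < \<pi> $ i" using Q by (simp add: reversible_generator_def)
  have edge: "((\<lambda>s. legendre (L j k) (dgrad Q \<pi> (v (p + s *\<^sub>R ?e)) j k)
        * edge_activation \<theta> \<pi> j k (p + s *\<^sub>R ?e)) has_real_derivative ?A j k + ?B j k) ?at"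
    if jk: "(j, k) \<in> ?E" for j k
  proof -
    have grad: "((\<lambda>s. dgrad Q \<pi> (v (p + s *\<^sub>R ?e)) j k) has_real_derivative dgrad Q \<pi> ?w j k) ?at"
      unfolding dgrad_def vec_lambda_beta
      by (intro DERIV_cmult DERIV_diff has_derivative_partial_p[OF v])
    have "legendre (L j k) differentiable (at (dgrad Q \<pi> (v p) j k))"
      using L jk by (auto simp: edge_lagrangians_def intro: legendre_differentiable)
    then have "(legendre (L j k) has_real_derivative
        deriv (legendre (L j k)) (dgrad Q \<pi> (v p) j k)) (at (dgrad Q \<pi> (v (p + 0 *\<^sub>R ?e)) j k))"
      by (simp add: DERIV_deriv_iff_real_differentiable)
    from DERIV_chain2[OF this grad]
    have "((\<lambda>s. legendre (L j k) (dgrad Q \<pi> (v (p + s *\<^sub>R ?e)) j k)) has_real_derivative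
        deriv (legendre (L j k)) (dgrad Q \<pi> (v p) j k) * dgrad Q \<pi> ?w j k) ?at" .
    moreover have "partial_p_exists D i (edge_activation \<theta> \<pi> j k) p"
      using edge_activation_has_derivative[OF \<theta> \<pi> D] partial_p_exists_if_has_derivative by blast
    note has_derivative_partial_p[OF this]
    ultimately show ?thesis
      by (auto intro!: derivative_eq_intros simp: algebra_simps)
  qed
  have "((\<lambda>s. hamiltonian Q \<pi> \<theta> L F (p + s *\<^sub>R ?e) (v (p + s *\<^sub>R ?e))) has_real_derivative
      1/2 * (\<Sum>(j, k)\<in>?E. ?A j k + ?B j k) + partial_p D i F p) ?at"
    unfolding hamiltonian_def
    by (intro DERIV_add DERIV_cmult has_derivative_partial_p[OF F] DERIV_sum)
      (use edge in \<open>auto simp: case_prod_unfold\<close>)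
  then have "partial_p D i (\<lambda>q. hamiltonian Q \<pi> \<theta> L F q (v q)) p
      = 1/2 * (\<Sum>(j, k)\<in>?E. ?A j k + ?B j k) + partial_p D i F p"
    by (rule has_derivative_coord_lineD(2)[OF D])
  also have "(\<Sum>(j, k)\<in>?E. ?A j k + ?B j k) = (\<Sum>(j, k)\<in>?E. ?A j k) + (\<Sum>(j, k)\<in>?E. ?B j k)"
    by (simp add: sum.distrib case_prod_unfold)
  also have "(\<Sum>(j, k)\<in>?E. ?A j k) = 2 * (\<Sum>j\<in>{j. (i, j) \<in> ?E}. ?A i j)"
  proof (rule edge_sum_only_incident)
    fix j k assume jk: "(j, k) \<in> ?E"
    show "j \<noteq> k \<and> (k, j) \<in> ?E"
      using jk weight_symmetric[OF Q, of j k] by (auto simp: edges_def)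
    have "dgrad Q \<pi> (v p) k j = - dgrad Q \<pi> (v p) j k"
      using weight_symmetric[OF Q, of j k] by (simp add: dgrad_def algebra_simps)
    moreover have "L k j = L j k" "\<And>a. L j k (- a) = L j k a"
      using L jk by (auto simp: edge_lagrangians_def)
    ultimately have "legendre (L k j) (dgrad Q \<pi> (v p) k j) = legendre (L j k) (dgrad Q \<pi> (v p) j k)"
      by (simp add: legendre_even)
    moreover have "partial_p D i (edge_activation \<theta> \<pi> k j) p = partial_p D i (edge_activation \<theta> \<pi> j k) p"
    proof (rule partial_p_cong[OF D(2)])
      fix q assume "q \<in> D"
      then have "0 \<le> q $ k / \<pi> $ k" "0 \<le> q $ j / \<pi> $ j"
        using coordinate_domain_nonneg[OF D(1)] \<pi> by (simp_all add: divide_nonneg_pos)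
      then show "edge_activation \<theta> \<pi> k j q = edge_activation \<theta> \<pi> j k q"
        using \<theta> by (simp add: activation_def edge_activation_def)
    qed
    ultimately show "?A j k = ?A k j" by simp
    assume "j \<noteq> i" "k \<noteq> i"
    then have "(\<lambda>s. edge_activation \<theta> \<pi> j k (p + s *\<^sub>R ?e)) = (\<lambda>s. edge_activation \<theta> \<pi> j k p)"
      by (simp add: edge_activation_def axis_def)
    then have "partial_p D i (edge_activation \<theta> \<pi> j k) p = 0"
      using has_derivative_coord_lineD(2)[OF D, of "edge_activation \<theta> \<pi> j k" i 0] by simp
    then show "?A j k = 0" by simp
  qed
  finally show ?thesis by (simp add: neighbours_def)
qed

section \<open>The master equation\<close>

theorem proposition3p16:
  fixes Q :: "real^'n^'n" and \<pi> :: "real^'n"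
    and \<theta> :: "real \<Rightarrow> real \<Rightarrow> real" and L :: "'n \<Rightarrow> 'n \<Rightarrow> real \<Rightarrow> real"
    and D :: "(real^'n) set" and F G :: "real^'n \<Rightarrow> real" and T :: real
    and U :: "real^'n \<Rightarrow> real \<Rightarrow> real" and u :: "real^'n \<Rightarrow> real \<Rightarrow> real^'n"
  assumes "reversible_generator Q \<pi>"
    and "activation \<theta>"
    and "edge_lagrangians (edges Q \<pi>) L"
    and "coordinate_domain D"
    and "C1_on D F" and "C1_on D G"
    and "classical_HJ_solution D T (hamiltonian Q \<pi> \<theta> L F) G U"
    and u: "\<And>p t. u p t = grad_p D (\<lambda>q. U q t) p"
  shows
    "(\<forall>i. \<forall>p\<in>D. \<forall>t\<le>T.
        partial_p_exists D i (\<lambda>q. hamiltonian Q \<pi> \<theta> L F q (u q t)) p \<and>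
        partial_t T (\<lambda>s. u p s $ i) t
          + partial_p D i (\<lambda>q. hamiltonian Q \<pi> \<theta> L F q (u q t)) p = 0) \<and>
     (\<forall>(j, k)\<in>edges Q \<pi>. \<forall>b. legendre (L j k) differentiable (at b)) \<and>
     (\<forall>i. \<forall>p\<in>D. \<forall>t\<le>T.
        partial_t T (\<lambda>s. u p s $ i) t
          + (\<Sum>j\<in>neighbours Q \<pi> i.
               legendre (L i j) (dgrad Q \<pi> (u p t) i j) * partial_p D i (edge_activation \<theta> \<pi> i j) p)
          + partial_p D i F p
          + 1/2 * (\<Sum>(j, k)\<in>edges Q \<pi>.
               deriv (legendre (L j k)) (dgrad Q \<pi> (u p t) j k)
               * dgrad Q \<pi> (grad_p D (\<lambda>q. u q t $ i) p) j k
               * edge_activation \<theta> \<pi> j k p) = 0) \<and>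
     (\<forall>p\<in>D. u p T = grad_p D G p)"
proof -
  let ?H = "hamiltonian Q \<pi> \<theta> L F"
  note D = assms(4)
  have ui: "u p t $ i = partial_p D i (\<lambda>q. U q t) p" for p t i
    by (simp add: u grad_p_def)
  have reg: "classical_regularity D T U"
    and HJ: "\<And>p t. \<lbrakk>p \<in> D; t \<le> T\<rbrakk> \<Longrightarrow> partial_t T (U p) t = - ?H p (u p t)"
    and terminal: "\<And>p. p \<in> D \<Longrightarrow> U p T = G p"
    using assms(7) unfolding classical_HJ_solution_def u by (auto simp: eq_neg_iff_add_eq_0)
  have regt: "cont_partial_t D T U" "\<And>i. cont_partial_p D T i U"
    "\<And>i. cont_partial_t D T (\<lambda>p t. partial_p D i (\<lambda>q. U q t) p)"
    "\<And>i k. cont_partial_p D T k (\<lambda>p t. partial_p D i (\<lambda>q. U q t) p)"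
    using reg unfolding classical_regularity_def by blast+
  have total: "partial_p_exists D i (\<lambda>q. ?H q (u q t)) p"
    "partial_p D i (\<lambda>q. ?H q (u q t)) p = - partial_t T (\<lambda>s. u p s $ i) t"
    if p: "p \<in> D" and t: "t \<le> T" for i p t
  proof -
    have "((\<lambda>s. - partial_t T (U (p + s *\<^sub>R axis i 1)) t) has_real_derivative
        - partial_t T (\<lambda>s. u p s $ i) t) (at 0 within coord_line D i p)"
      using partial_t_partial_p_commute[OF D p t regt(1-3), of i]
      unfolding ui by (rule DERIV_minus)
    then have "((\<lambda>s. ?H (p + s *\<^sub>R axis i 1) (u (p + s *\<^sub>R axis i 1) t)) has_real_derivative
        - partial_t T (\<lambda>s. u p s $ i) t) (at 0 within coord_line D i p)"
      by (rule has_field_derivative_transform_within[where d = 1])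
        (use HJ t p in \<open>auto simp: coord_line_def\<close>)
    note has_derivative_coord_lineD[OF D p this]
    then show "partial_p_exists D i (\<lambda>q. ?H q (u q t)) p"
      "partial_p D i (\<lambda>q. ?H q (u q t)) p = - partial_t T (\<lambda>s. u p s $ i) t"
      by blast+
  qed
  have symmetric: "(\<chi> k. partial_p D i (\<lambda>q. u q t $ k) p) = grad_p D (\<lambda>q. u q t $ i) p"
    if p: "p \<in> D" and t: "t \<le> T" for i p t
  proof -
    have "partial_p D i (partial_p D k (\<lambda>q. U q t)) p = partial_p D k (partial_p D i (\<lambda>q. U q t)) p" for k
    proof (rule partial_p_symmetric[OF D p])
      show "partial_p_exists D i (\<lambda>q. U q t) q" if "q \<in> D" for i q
        using regt(2)[of i] that t by (simp add: cont_partial_p_def)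
      show "partial_p_exists D k (partial_p D i (\<lambda>q. U q t)) q" if "q \<in> D" for q
        using regt(4)[of k i] that t by (simp add: cont_partial_p_def)
      have "continuous_on (D \<times> {..T}) (\<lambda>(q, t). partial_p D k (partial_p D i (\<lambda>q. U q t)) q)"
        using regt(4)[of k i] by (simp add: cont_partial_p_def)
      then have "continuous_on D
          (\<lambda>q. (\<lambda>(q, t). partial_p D k (partial_p D i (\<lambda>q. U q t)) q) (q, t))"
        by (rule continuous_on_compose2) (use t in \<open>auto intro!: continuous_intros\<close>)
      then show "continuous_on D (partial_p D k (partial_p D i (\<lambda>q. U q t)))" by simp
    qed
    then show ?thesis by (simp add: grad_p_def ui vec_eq_iff)
  qed
  have master: "partial_p D i (\<lambda>q. ?H q (u q t)) p =
      (\<Sum>j\<in>neighbours Q \<pi> i.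
         legendre (L i j) (dgrad Q \<pi> (u p t) i j) * partial_p D i (edge_activation \<theta> \<pi> i j) p)
      + partial_p D i F p
      + 1/2 * (\<Sum>(j, k)\<in>edges Q \<pi>.
         deriv (legendre (L j k)) (dgrad Q \<pi> (u p t) j k)
         * dgrad Q \<pi> (grad_p D (\<lambda>q. u q t $ i) p) j k
         * edge_activation \<theta> \<pi> j k p)"
    if p: "p \<in> D" and t: "t \<le> T" for i p t
  proof -
    have F: "partial_p_exists D i F p"
      using assms(5) p partial_p_exists_if_has_derivative unfolding C1_on_def by blast
    have v: "partial_p_exists D i (\<lambda>q. u q t $ k) p" for k
      using regt(4)[of i k] p t unfolding ui by (simp add: cont_partial_p_def)
    show ?thesis
      using hamiltonian_total_derivative[OF assms(1-3) D p F, of "\<lambda>q. u q t", OF v]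
      unfolding symmetric[OF p t] .
  qed
  show ?thesis
  proof (intro conjI allI ballI impI)
    fix i p t assume p: "p \<in> D" and t: "t \<le> T"
    show "partial_p_exists D i (\<lambda>q. ?H q (u q t)) p"
      "partial_t T (\<lambda>s. u p s $ i) t + partial_p D i (\<lambda>q. ?H q (u q t)) p = 0"
      using total[OF p t] by simp_all
    show "partial_t T (\<lambda>s. u p s $ i) t
          + (\<Sum>j\<in>neighbours Q \<pi> i.
               legendre (L i j) (dgrad Q \<pi> (u p t) i j) * partial_p D i (edge_activation \<theta> \<pi> i j) p)
          + partial_p D i F p
          + 1/2 * (\<Sum>(j, k)\<in>edges Q \<pi>.
               deriv (legendre (L j k)) (dgrad Q \<pi> (u p t) j k)
               * dgrad Q \<pi> (grad_p D (\<lambda>q. u q t $ i) p) j k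
               * edge_activation \<theta> \<pi> j k p) = 0"
      using total(2)[OF p t, of i] master[OF p t, of i] by simp
  next
    fix x assume "x \<in> edges Q \<pi>"
    then show "case x of (j, k) \<Rightarrow> \<forall>b. legendre (L j k) differentiable (at b)"
      using assms(3) by (auto simp: edge_lagrangians_def intro!: legendre_differentiable)
  next
    fix p assume p: "p \<in> D"
    show "u p T = grad_p D G p"
      unfolding u grad_p_def using partial_p_cong[OF p terminal] by simp
  qed
qed

end
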